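(* Let $m\ge 1$ be an integer and $q\in(0,1)$. Let $H_1,\dots,H_m$ be null hypotheses, let $I_0\subseteq\{1,\dots,m\}$ be the set of indices of the true null hypotheses, and let $P_1,\dots,P_m$ be the corresponding $[0,1]$-valued random $p$-values, where $P_i$ is distributed as $U(0,1)$ for every $i\in I_0$. Assume that $P_1,\dots,P_m$ are PRDS on the subset of null $p$-values $\{P_i: i\in I_0\}$. Let $\beta_m$ be any real number with $\beta_m\ge m(1-q)$, and let $\alpha_1\le\cdots\le\alpha_m$ be the constants satisfying $$\frac{\alpha_i}{1-\alpha_i}=\frac{iq}{m-i+\beta_m},\qquad i=1,\dots,m.$$ Then the step-down procedure with critical values $\alpha_1,\dots,\alpha_m$ controls the false discovery rate at $q$, that is, $$\mathrm{FDR}=E\left[\frac{V}{R}\,I_{\{R>0\}}\right]\le q,$$ where $R$ is the number of null hypotheses rejected by the procedure and $V$ is the number of true null hypotheses rejected by it.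
   Context: PRDS (positive regression dependence on the subset of null $p$-values): for each $i\in I_0$ and any coordinatewise increasing (respectively decreasing) function $\phi$ of $(P_1,\dots,P_m)$ (measurable, with the expectation existing), the conditional expectation $E\{\phi(P_1,\dots,P_m)\mid P_i=u\}$ is increasing (respectively decreasing) in $u$. Here increasing and decreasing are meant in the weak sense (nondecreasing, nonincreasing). Step-down procedure with critical values $\alpha_1\le\cdots\le\alpha_m$: sort the $p$-values as $P_{(1)}\le\cdots\le P_{(m)}$ and let $H_{(i)}$ be the null hypothesis corresponding to $P_{(i)}$. Let $k=\max\{1\le i\le m: P_{(j)}\le\alpha_j \text{ for all } j=1,\dots,i\}$. If such a $k$ exists, reject the $k$ hypotheses $H_{(1)},\dots,H_{(k)}$; otherwise reject no hypothesis. The total number of rejected hypotheses is $R$, and $V$ is the number of rejected hypotheses $H_i$ with $i\in I_0$. The quantity $\frac{V}{R}I_{\{R>0\}}$ is understood to be $0$ when $R=0$. *)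

theory Defs
  imports "HOL-Probability.Probability"
begin

text \<open>
  The hypotheses are identified with their indices \<open>1, \<dots>, m\<close>, and a vector of p-values is a
  function on \<open>{1..m}\<close>.
\<close>

text \<open>
  \<open>g\<close> is a version of \<open>u \<mapsto> E(Y | X = u)\<close>: the conditional expectation of \<open>Y\<close> given the sigma-algebra
  generated by \<open>X\<close> factorises almost surely as \<open>g \<circ> X\<close>.
\<close>
definition cond_exp_version ::
    "'a measure \<Rightarrow> ('a \<Rightarrow> real) \<Rightarrow> ('a \<Rightarrow> real) \<Rightarrow> (real \<Rightarrow> real) \<Rightarrow> bool" where
  "cond_exp_version M Y X g \<longleftrightarrow>
     g \<in> borel_measurable borel \<and>
     (AE \<omega> in M. real_cond_exp M (vimage_algebra (space M) X borel) Y \<omega> = g (X \<omega>))"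

definition pvec :: "nat \<Rightarrow> (nat \<Rightarrow> 'a \<Rightarrow> real) \<Rightarrow> 'a \<Rightarrow> nat \<Rightarrow> real" where
  "pvec m P \<omega> = (\<lambda>j\<in>{1..m}. P j \<omega>)"

abbreviation cube :: "nat \<Rightarrow> (nat \<Rightarrow> real) set" where
  "cube m \<equiv> {1..m} \<rightarrow>\<^sub>E {0..1}"

text \<open>
  The p-values lie in \<open>[0,1]\<close>, so monotonicity of \<open>\<phi>\<close> is only required on the cube and monotonicity
  in \<open>u\<close> only on \<open>[0,1]\<close>.  Two vectors in the cube agree outside \<open>{1..m}\<close>, hence the
  pointwise order of functions is the coordinatewise order there.  Conditional
  expectations being unique only up to null sets, monotonicity in \<open>u\<close> means that some version is
  monotone.
\<close>
definition PRDS :: "'a measure \<Rightarrow> nat \<Rightarrow> (nat \<Rightarrow> 'a \<Rightarrow> real) \<Rightarrow> nat set \<Rightarrow> bool" where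
  "PRDS M m P I0 \<longleftrightarrow>
     (\<forall>i\<in>I0. \<forall>\<phi>\<in>borel_measurable (\<Pi>\<^sub>M j\<in>{1..m}. borel).
        integrable M (\<lambda>\<omega>. \<phi> (pvec m P \<omega>)) \<longrightarrow>
        (mono_on (cube m) \<phi> \<longrightarrow>
           (\<exists>g. cond_exp_version M (\<lambda>\<omega>. \<phi> (pvec m P \<omega>)) (P i) g \<and> mono_on {0..1} g)) \<and>
        (antimono_on (cube m) \<phi> \<longrightarrow>
           (\<exists>g. cond_exp_version M (\<lambda>\<omega>. \<phi> (pvec m P \<omega>)) (P i) g \<and> antimono_on {0..1} g)))"

text \<open>
  \<open>ordered_hyp m p i\<close> is the index of the hypothesis with the \<open>i\<close>-th smallest p-value, \<open>1 \<le> i \<le> m\<close>.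
  Ties are broken by index; for nondecreasing critical values the set of rejected hypotheses does
  not depend on how ties are broken.
\<close>
definition ordered_hyp :: "nat \<Rightarrow> (nat \<Rightarrow> real) \<Rightarrow> nat \<Rightarrow> nat" where
  "ordered_hyp m p i = sort_key p [1..<Suc m] ! (i - 1)"

definition ordered_pval :: "nat \<Rightarrow> (nat \<Rightarrow> real) \<Rightarrow> nat \<Rightarrow> real" where
  "ordered_pval m p i = p (ordered_hyp m p i)"

definition stepdown_indices :: "nat \<Rightarrow> (nat \<Rightarrow> real) \<Rightarrow> (nat \<Rightarrow> real) \<Rightarrow> nat set" where
  "stepdown_indices m \<alpha> p = {i\<in>{1..m}. \<forall>j\<in>{1..i}. ordered_pval m p j \<le> \<alpha> j}"

definition stepdown_rejected :: "nat \<Rightarrow> (nat \<Rightarrow> real) \<Rightarrow> (nat \<Rightarrow> real) \<Rightarrow> nat set" where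
  "stepdown_rejected m \<alpha> p =
     (if stepdown_indices m \<alpha> p = {} then {}
      else ordered_hyp m p ` {1..Max (stepdown_indices m \<alpha> p)})"

definition num_rejected :: "nat \<Rightarrow> (nat \<Rightarrow> real) \<Rightarrow> (nat \<Rightarrow> real) \<Rightarrow> nat" where
  "num_rejected m \<alpha> p = card (stepdown_rejected m \<alpha> p)"

definition num_false_rejected ::
    "nat \<Rightarrow> nat set \<Rightarrow> (nat \<Rightarrow> real) \<Rightarrow> (nat \<Rightarrow> real) \<Rightarrow> nat" where
  "num_false_rejected m I0 \<alpha> p = card (stepdown_rejected m \<alpha> p \<inter> I0)"

definition FDR ::
    "'a measure \<Rightarrow> nat \<Rightarrow> nat set \<Rightarrow> (nat \<Rightarrow> real) \<Rightarrow> (nat \<Rightarrow> 'a \<Rightarrow> real) \<Rightarrow> real" where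
  "FDR M m I0 \<alpha> P =
     (\<integral>\<omega>. (let p = pvec m P \<omega>; R = num_rejected m \<alpha> p; V = num_false_rejected m I0 \<alpha> p
          in if R > 0 then real V / real R else 0) \<partial>M)"

end

theory Submission
  imports Defs
begin

text \<open>
  The bound \<open>\<beta> \<ge> m (1 - q)\<close> forces \<open>\<alpha>\<^sub>i \<le> i q / m\<close>: the critical values lie below those of
  Benjamini and Hochberg.  Put \<open>c = q / m\<close>.  A hypothesis rejected at rank \<open>j \<le> R\<close> has a p-value
  at most \<open>\<alpha>\<^sub>j \<le> c j \<le> c R\<close>, so \<open>V / R\<close> is at most the sum over the true nulls \<open>i\<close> of
  \<open>1{R > 0, P\<^sub>i \<le> c R} / R\<close>, and it suffices that each of these terms has expectation at most \<open>c\<close>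
  (\<open>expectation_inverse_rejections\<close>).

  The number of rejections is a nonincreasing function of the p-values, so PRDS makes
  \<open>Pr(R \<ge> j | P\<^sub>i = u)\<close> nonincreasing in \<open>u\<close>, and then so is the average of this function over
  \<open>[0, t]\<close>, which is \<open>Pr(P\<^sub>i \<le> t, R \<ge> j) / t\<close> (\<open>average_antimono\<close>).  Splitting according to the
  value of \<open>R\<close>,
  \<open>E[1{R > 0, P\<^sub>i \<le> c R} / R] = (\<Sum>j=1..m. (Pr(P\<^sub>i \<le> c j, R \<ge> j) - Pr(P\<^sub>i \<le> c j, R \<ge> j + 1)) / j)\<close>,
  and replacing \<open>c j\<close> by \<open>c (j + 1)\<close> in the averages of the negative terms turns this into a
  telescoping upper bound with first term \<open>Pr(P\<^sub>i \<le> c, R \<ge> 1) \<le> c\<close>.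
\<close>

section \<open>Averages of a monotone regression function\<close>

text \<open>
  The value \<open>g s\<close> separates the two ranges: it is a lower bound for the regression function on
  \<open>[0, s]\<close> and an upper bound on \<open>(s, t]\<close>, so extending the range lowers the average.
\<close>
lemma (in prob_space) average_antimono:
  fixes X Y :: "'a \<Rightarrow> real"
  assumes X [measurable]: "X \<in> borel_measurable M"
    and X01: "\<And>\<omega>. \<omega> \<in> space M \<Longrightarrow> X \<omega> \<in> {0..1}"
    and unif: "\<And>t. t \<in> {0..1} \<Longrightarrow> prob {\<omega>\<in>space M. X \<omega> \<le> t} = t"
    and Y: "integrable M Y"
    and version: "cond_exp_version M Y X g"
    and anti: "antimono_on {0..1} g"
    and st: "0 \<le> s" "s \<le> t" "t \<le> 1"
  shows "s * (\<integral>\<omega>. indicator {..t} (X \<omega>) * Y \<omega> \<partial>M) \<le> t * (\<integral>\<omega>. indicator {..s} (X \<omega>) * Y \<omega> \<partial>M)"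
proof -
  define F where "F = vimage_algebra (space M) X borel"
  have sub: "subalgebra M F"
    unfolding subalgebra_def F_def by (auto simp: sets_vimage_algebra2 intro: measurable_sets)
  interpret F: finite_measure_subalgebra M F
    by unfold_locales (rule sub)
  have g [measurable]: "g \<in> borel_measurable borel"
    and gAE: "AE \<omega> in M. real_cond_exp M F Y \<omega> = g (X \<omega>)"
    using version by (auto simp: cond_exp_version_def F_def)
  have int_g: "integrable M (\<lambda>\<omega>. g (X \<omega>))"
    by (rule integrable_cong_AE_imp[OF F.real_cond_exp_int(1)[OF Y]]) (use gAE in auto)
  have int_ind: "integrable M (\<lambda>\<omega>. indicator A (X \<omega>) * g (X \<omega>))"
    if [measurable]: "A \<in> sets borel" for A
    by (rule Bochner_Integration.integrable_bound[OF int_g]) (auto simp: indicator_def)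
  have regress: "(\<integral>\<omega>. indicator A (X \<omega>) * Y \<omega> \<partial>M) = (\<integral>\<omega>. indicator A (X \<omega>) * g (X \<omega>) \<partial>M)"
    if A [measurable]: "A \<in> sets borel" for A
  proof -
    let ?B = "X -` A \<inter> space M"
    have B: "?B \<in> sets F"
      unfolding F_def by (rule in_vimage_algebra) fact
    have "(\<integral>\<omega>. indicator A (X \<omega>) * Y \<omega> \<partial>M) = (\<integral>\<omega>\<in>?B. Y \<omega> \<partial>M)"
      unfolding set_lebesgue_integral_def
      by (intro Bochner_Integration.integral_cong) (auto simp: indicator_def)
    also have "\<dots> = (\<integral>\<omega>\<in>?B. real_cond_exp M F Y \<omega> \<partial>M)"
      using F.real_cond_exp_intA[OF Y B] .
    also have "\<dots> = (\<integral>\<omega>. indicator A (X \<omega>) * g (X \<omega>) \<partial>M)"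
      unfolding set_lebesgue_integral_def
      by (intro integral_cong_AE) (use gAE in \<open>auto simp: indicator_def elim!: eventually_mono\<close>)
    finally show ?thesis .
  qed
  have mass: "(\<integral>\<omega>. indicator {..x} (X \<omega>) * g s \<partial>M) = x * g s" if "x \<in> {0..1}" for x
  proof -
    have "(\<integral>\<omega>. indicator {..x} (X \<omega>) * g s \<partial>M)
        = (\<integral>\<omega>. indicator {\<omega>\<in>space M. X \<omega> \<le> x} \<omega> * g s \<partial>M)"
      by (intro Bochner_Integration.integral_cong) (auto simp: indicator_def)
    also have "\<dots> = prob {\<omega>\<in>space M. X \<omega> \<le> x} * g s"
      by simp
    finally show ?thesis
      using unif[OF that] by simp
  qed
  have int_const: "integrable M (\<lambda>\<omega>. indicator {..x} (X \<omega>) * g s)" for x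
    by (rule Bochner_Integration.integrable_bound[OF integrable_const[of "g s"]])
      (auto simp: indicator_def)
  let ?h = "\<lambda>x. \<integral>\<omega>. indicator {..x} (X \<omega>) * g (X \<omega>) \<partial>M"
  have s01: "s \<in> {0..1}" and t01: "t \<in> {0..1}"
    using st by auto
  have low: "s * g s \<le> ?h s"
  proof -
    have "(\<integral>\<omega>. indicator {..s} (X \<omega>) * g s \<partial>M) \<le> ?h s"
      using st X01
      by (intro integral_mono int_const int_ind)
        (auto simp: indicator_def intro!: monotone_onD[OF anti])
    thus ?thesis
      using s01 by (simp only: mass)
  qed
  have "?h t - ?h s \<le> t * g s - s * g s"
  proof -
    have "?h t - ?h s
        = (\<integral>\<omega>. indicator {..t} (X \<omega>) * g (X \<omega>) - indicator {..s} (X \<omega>) * g (X \<omega>) \<partial>M)"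
      by (intro Bochner_Integration.integral_diff[symmetric] int_ind) auto
    also have "\<dots> \<le> (\<integral>\<omega>. indicator {..t} (X \<omega>) * g s - indicator {..s} (X \<omega>) * g s \<partial>M)"
      using st X01
      by (intro integral_mono Bochner_Integration.integrable_diff int_const int_ind)
        (auto simp: indicator_def intro!: monotone_onD[OF anti])
    also have "\<dots> = t * g s - s * g s"
      using s01 t01 by (simp only: Bochner_Integration.integral_diff[OF int_const int_const] mass)
    finally show ?thesis .
  qed
  hence "s * (?h t - ?h s) \<le> s * (t * g s - s * g s)"
    using st by (intro mult_left_mono)
  also have "\<dots> = (t - s) * (s * g s)"
    by (simp add: algebra_simps)
  also have "\<dots> \<le> (t - s) * ?h s"
    using low st by (intro mult_left_mono) auto
  finally have "s * ?h t \<le> t * ?h s"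
    by (simp add: algebra_simps)
  thus ?thesis
    by (simp add: regress)
qed

text \<open>
  Here \<open>X\<close> is one true null p-value and \<open>R\<close> the number of rejections; the two may be dependent, as
  long as small values of \<open>X\<close> make large values of \<open>R\<close> more likely.
\<close>
lemma (in prob_space) expectation_inverse_rejections:
  fixes X :: "'a \<Rightarrow> real" and R :: "'a \<Rightarrow> nat"
  assumes X [measurable]: "X \<in> borel_measurable M"
    and X01: "\<And>\<omega>. \<omega> \<in> space M \<Longrightarrow> X \<omega> \<in> {0..1}"
    and unif: "\<And>t. t \<in> {0..1} \<Longrightarrow> prob {\<omega>\<in>space M. X \<omega> \<le> t} = t"
    and R [measurable]: "R \<in> measurable M (count_space UNIV)"
    and Rm: "\<And>\<omega>. \<omega> \<in> space M \<Longrightarrow> R \<omega> \<le> m"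
    and regress: "\<And>j. \<exists>g. cond_exp_version M (\<lambda>\<omega>. of_bool (j \<le> R \<omega>)) X g \<and> antimono_on {0..1} g"
    and c: "0 < c" "c * real m \<le> 1"
  shows "(\<integral>\<omega>. (if 0 < R \<omega> \<and> X \<omega> \<le> c * real (R \<omega>) then 1 / real (R \<omega>) else 0) \<partial>M) \<le> c"
proof (cases "m = 0")
  case True
  hence "(\<integral>\<omega>. (if 0 < R \<omega> \<and> X \<omega> \<le> c * real (R \<omega>) then 1 / real (R \<omega>) else 0) \<partial>M)
      = (\<integral>\<omega>. 0 \<partial>M)"
    using Rm by (intro Bochner_Integration.integral_cong) auto
  thus ?thesis using c by simp
next
  case False
  define h :: "real \<Rightarrow> nat \<Rightarrow> real"
    where "h x j = (\<integral>\<omega>. indicator {..x} (X \<omega>) * of_bool (j \<le> R \<omega>) \<partial>M)" for x j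
  define a where "a j = h (c * real j) j / real j" for j
  have int: "integrable M (\<lambda>\<omega>. indicator {..x} (X \<omega>) * of_bool (j \<le> R \<omega>) :: real)" for x j
    by (rule Bochner_Integration.integrable_bound[OF integrable_const[of "1::real"]])
      (auto simp: indicator_def)
  have h_nonneg: "0 \<le> h x j" for x j
    unfolding h_def by (intro Bochner_Integration.integral_nonneg) auto
  have h_le: "h x j \<le> x" if "x \<in> {0..1}" for x j
  proof -
    have "h x j \<le> (\<integral>\<omega>. indicator {\<omega>\<in>space M. X \<omega> \<le> x} \<omega> \<partial>M)"
      unfolding h_def
      by (intro integral_mono int integrable_real_indicator)
        (auto simp: indicator_def less_top[symmetric])
    thus ?thesis using unif[OF that] by simp
  qed
  have split: "(if 0 < R \<omega> \<and> X \<omega> \<le> c * real (R \<omega>) then 1 / real (R \<omega>) else 0)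
      = (\<Sum>j=1..m. (indicator {..c * real j} (X \<omega>) * of_bool (j \<le> R \<omega>)
          - indicator {..c * real j} (X \<omega>) * of_bool (Suc j \<le> R \<omega>)) / real j)"
    if "\<omega> \<in> space M" for \<omega>
  proof -
    have "(\<Sum>j=1..m. (indicator {..c * real j} (X \<omega>) * of_bool (j \<le> R \<omega>)
          - indicator {..c * real j} (X \<omega>) * of_bool (Suc j \<le> R \<omega>)) / real j)
      = (\<Sum>j=1..m. if j = R \<omega> then indicator {..c * real j} (X \<omega>) / real j else 0)"
      by (intro sum.cong) auto
    thus ?thesis using Rm[OF that] by (auto simp: indicator_def)
  qed
  \<comment> \<open>The negative term is the average of \<open>Pr(R \<ge> j + 1 | X = u)\<close> over \<open>[0, c j]\<close>, up to the factor
    \<open>c\<close>, which is at least the average over the longer interval \<open>[0, c (j + 1)]\<close>.\<close>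
  have step: "h (c * real j) j / real j - h (c * real j) (Suc j) / real j \<le> a j - a (Suc j)"
    if j: "j \<in> {1..<m}" for j
  proof -
    obtain g where g: "cond_exp_version M (\<lambda>\<omega>. of_bool (Suc j \<le> R \<omega>)) X g" "antimono_on {0..1} g"
      using regress by blast
    have "c * real (Suc j) \<le> c * real m"
      using j c by (intro mult_left_mono) auto
    hence "c * real (Suc j) \<le> 1"
      using c by linarith
    moreover have "integrable M (\<lambda>\<omega>. of_bool (Suc j \<le> R \<omega>) :: real)"
      by (rule Bochner_Integration.integrable_bound[OF integrable_const[of "1::real"]]) auto
    ultimately have "(c * real j) * h (c * real (Suc j)) (Suc j) \<le> (c * real (Suc j)) * h (c * real j) (Suc j)"
      unfolding h_def using c
      by (intro average_antimono[OF X X01 unif _ g]) auto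
    hence "real j * h (c * real (Suc j)) (Suc j) \<le> real (Suc j) * h (c * real j) (Suc j)"
      using c by (simp only: mult.assoc mult_le_cancel_left_pos)
    hence "a (Suc j) \<le> h (c * real j) (Suc j) / real j"
      using j by (simp add: a_def field_simps)
    thus ?thesis by (simp add: a_def)
  qed
  have "(\<integral>\<omega>. (if 0 < R \<omega> \<and> X \<omega> \<le> c * real (R \<omega>) then 1 / real (R \<omega>) else 0) \<partial>M)
      = (\<integral>\<omega>. (\<Sum>j=1..m. (indicator {..c * real j} (X \<omega>) * of_bool (j \<le> R \<omega>)
          - indicator {..c * real j} (X \<omega>) * of_bool (Suc j \<le> R \<omega>)) / real j) \<partial>M)"
    by (intro Bochner_Integration.integral_cong split) auto
  also have "\<dots> = (\<Sum>j=1..m. h (c * real j) j / real j - h (c * real j) (Suc j) / real j)"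
    unfolding h_def
    by (subst Bochner_Integration.integral_sum)
      (auto intro!: sum.cong integrable_divide Bochner_Integration.integrable_diff int
            simp: Bochner_Integration.integral_diff[OF integrable_divide[OF int] integrable_divide[OF int]]
              diff_divide_distrib)
  also have "\<dots> = (\<Sum>j=1..<m. h (c * real j) j / real j - h (c * real j) (Suc j) / real j)
      + (h (c * real m) m / real m - h (c * real m) (Suc m) / real m)"
    using False by (cases m) (auto simp: atLeastLessThanSuc_atLeastAtMost)
  also have "\<dots> \<le> (\<Sum>j=1..<m. a j - a (Suc j)) + a m"
    using h_nonneg[of "c * real m" "Suc m"]
    by (intro add_mono sum_mono step) (auto simp: a_def)
  also have "\<dots> = a 1"
    using sum_Suc_diff'[of 1 m "\<lambda>j. - a j"] False by (simp add: sum_subtractf sum_negf)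
  also have "\<dots> \<le> c"
  proof -
    have "c * 1 \<le> c * real m"
      using False c by (intro mult_left_mono) auto
    hence "c \<le> 1"
      using c by linarith
    thus ?thesis using h_le[of c 1] c by (simp add: a_def)
  qed
  finally show ?thesis .
qed

section \<open>The step-down procedure\<close>

lemma bij_betw_ordered_hyp: "bij_betw (ordered_hyp m p) {1..m} {1..m}"
proof -
  let ?xs = "sort_key p [1..<Suc m]"
  have "bij_betw (\<lambda>i. ?xs ! i) {..<m} {1..m}"
    by (rule bij_betw_nth) auto
  moreover have "bij_betw (\<lambda>i. i - 1) {1..m} {..<m}"
    by (rule bij_betw_byWitness[where f' = Suc]) auto
  ultimately have "bij_betw ((\<lambda>i. ?xs ! i) \<circ> (\<lambda>i. i - 1)) {1..m} {1..m}"
    by (rule bij_betw_trans[rotated])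
  thus ?thesis
    by (simp add: ordered_hyp_def[abs_def] o_def)
qed

lemma ordered_pval_mono:
  assumes "1 \<le> i" "i \<le> j" "j \<le> m"
  shows "ordered_pval m p i \<le> ordered_pval m p j"
proof -
  let ?xs = "sort_key p [1..<Suc m]"
  have "map p ?xs ! (i - 1) \<le> map p ?xs ! (j - 1)"
    using assms by (intro sorted_nth_mono sorted_sort_key) auto
  thus ?thesis
    using assms by (simp add: ordered_pval_def ordered_hyp_def del: upt_Suc)
qed

text \<open>
  Counting p-values replaces sorting, which makes both the measurability and the monotonicity of
  the procedure evident.
\<close>
lemma ordered_pval_le_iff:
  assumes j: "j \<in> {1..m}"
  shows "ordered_pval m p j \<le> t \<longleftrightarrow> j \<le> card {l\<in>{1..m}. p l \<le> t}"
proof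
  have inj: "inj_on (ordered_hyp m p) {1..m}" and im: "ordered_hyp m p ` {1..m} = {1..m}"
    using bij_betw_ordered_hyp[of m p] by (auto simp: bij_betw_def)
  {
    assume le: "ordered_pval m p j \<le> t"
    have "card (ordered_hyp m p ` {1..j}) \<le> card {l\<in>{1..m}. p l \<le> t}"
    proof (rule card_mono)
      show "ordered_hyp m p ` {1..j} \<subseteq> {l\<in>{1..m}. p l \<le> t}"
      proof safe
        fix i assume i: "i \<in> {1..j}"
        show "ordered_hyp m p i \<in> {1..m}"
          using i j im by auto
        show "p (ordered_hyp m p i) \<le> t"
          using ordered_pval_mono[of i j m p] i j le by (simp add: ordered_pval_def)
      qed
    qed simp
    thus "j \<le> card {l\<in>{1..m}. p l \<le> t}"
      using j by (subst (asm) card_image) (auto intro: inj_on_subset[OF inj])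
  }
  assume card: "j \<le> card {l\<in>{1..m}. p l \<le> t}"
  show "ordered_pval m p j \<le> t"
  proof (rule ccontr)
    assume gt: "\<not> ordered_pval m p j \<le> t"
    have "{l\<in>{1..m}. p l \<le> t} \<subseteq> ordered_hyp m p ` {1..<j}"
    proof safe
      fix l assume l: "l \<in> {1..m}" "p l \<le> t"
      then obtain i where i: "i \<in> {1..m}" "l = ordered_hyp m p i"
        using im by blast
      have "\<not> j \<le> i"
        using ordered_pval_mono[of j i m p] i j gt l by (auto simp: ordered_pval_def)
      thus "l \<in> ordered_hyp m p ` {1..<j}"
        using i by auto
    qed
    hence "card {l\<in>{1..m}. p l \<le> t} \<le> card (ordered_hyp m p ` {1..<j})"
      by (intro card_mono) auto
    also have "\<dots> \<le> card {1..<j}"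
      by (rule card_image_le) simp
    finally show False
      using card j by auto
  qed
qed

lemma stepdown_indices_eq:
  "stepdown_indices m \<alpha> p = {i\<in>{1..m}. \<forall>j\<in>{1..i}. j \<le> card {l\<in>{1..m}. p l \<le> \<alpha> j}}"
  unfolding stepdown_indices_def by (auto simp: ordered_pval_le_iff)

lemma stepdown_indices_subset: "stepdown_indices m \<alpha> p \<subseteq> {1..m}"
  unfolding stepdown_indices_def by blast

lemma stepdown_indices_downward:
  assumes "i \<in> stepdown_indices m \<alpha> p" "1 \<le> j" "j \<le> i"
  shows "j \<in> stepdown_indices m \<alpha> p"
  using assms unfolding stepdown_indices_def by auto

lemma Max_stepdown_indices_in:
  "stepdown_indices m \<alpha> p \<noteq> {} \<Longrightarrow> Max (stepdown_indices m \<alpha> p) \<in> stepdown_indices m \<alpha> p"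
  by (meson Max_in finite_atLeastAtMost finite_subset stepdown_indices_subset)

lemma num_rejected_eq:
  "num_rejected m \<alpha> p = (if stepdown_indices m \<alpha> p = {} then 0 else Max (stepdown_indices m \<alpha> p))"
proof (cases "stepdown_indices m \<alpha> p = {}")
  case False
  hence "Max (stepdown_indices m \<alpha> p) \<le> m"
    using Max_stepdown_indices_in stepdown_indices_subset by fastforce
  hence "inj_on (ordered_hyp m p) {1..Max (stepdown_indices m \<alpha> p)}"
    by (intro inj_on_subset[OF bij_betw_imp_inj_on[OF bij_betw_ordered_hyp]]) auto
  thus ?thesis
    using False by (simp add: num_rejected_def stepdown_rejected_def card_image)
qed (simp add: num_rejected_def stepdown_rejected_def)

lemma le_num_rejected_iff:
  assumes "1 \<le> j"
  shows "j \<le> num_rejected m \<alpha> p \<longleftrightarrow> j \<in> stepdown_indices m \<alpha> p"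
proof (cases "stepdown_indices m \<alpha> p = {}")
  case False
  have fin: "finite (stepdown_indices m \<alpha> p)"
    by (rule finite_subset[OF stepdown_indices_subset]) simp
  show ?thesis
    using stepdown_indices_downward[OF Max_stepdown_indices_in[OF False] assms] Max_ge[OF fin] False
    by (auto simp: num_rejected_eq)
qed (use assms in \<open>simp add: num_rejected_eq\<close>)

lemma num_rejected_le: "num_rejected m \<alpha> p \<le> m"
  using le_num_rejected_iff[of "num_rejected m \<alpha> p" m \<alpha> p]
    stepdown_indices_subset[of m \<alpha> p]
  by (cases "num_rejected m \<alpha> p = 0") auto

lemma num_rejected_antimono:
  assumes "p \<le> p'"
  shows "num_rejected m \<alpha> p' \<le> num_rejected m \<alpha> p"
proof (cases "num_rejected m \<alpha> p' = 0")
  case False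
  have sub: "stepdown_indices m \<alpha> p' \<subseteq> stepdown_indices m \<alpha> p"
  proof -
    have "card {l\<in>{1..m}. p' l \<le> t} \<le> card {l\<in>{1..m}. p l \<le> t}" for t
      using assms by (intro card_mono) (auto simp: le_fun_def intro: order_trans)
    thus ?thesis
      unfolding stepdown_indices_eq by (auto intro: order_trans)
  qed
  have "num_rejected m \<alpha> p' \<in> stepdown_indices m \<alpha> p'"
    using False le_num_rejected_iff[of "num_rejected m \<alpha> p'" m \<alpha> p'] by simp
  with sub show ?thesis
    using False by (subst le_num_rejected_iff) auto
qed simp

lemma measurable_of_bool_le_num_rejected:
  "(\<lambda>p. of_bool (j \<le> num_rejected m \<alpha> p) :: real) \<in> borel_measurable (\<Pi>\<^sub>M j\<in>{1..m}. borel)"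
proof (cases "j \<in> {1..m}")
  case True
  have "(j \<le> num_rejected m \<alpha> p) \<longleftrightarrow>
      (\<forall>i\<in>{1..j}. real i \<le> (\<Sum>l\<in>{1..m}. if p l \<le> \<alpha> i then 1 else 0))" for p
  proof -
    have "real (card {l\<in>{1..m}. p l \<le> \<alpha> i}) = (\<Sum>l\<in>{1..m}. if p l \<le> \<alpha> i then 1 else 0)" for i
      by (simp add: sum.If_cases Int_def)
    hence "i \<le> card {l\<in>{1..m}. p l \<le> \<alpha> i} \<longleftrightarrow>
        real i \<le> (\<Sum>l\<in>{1..m}. if p l \<le> \<alpha> i then 1 else 0)" for i
      by (metis of_nat_le_iff)
    thus ?thesis
      using True by (auto simp: le_num_rejected_iff stepdown_indices_eq)
  qed
  moreover have "(\<lambda>p. of_bool (\<forall>i\<in>{1..j}. real i \<le> (\<Sum>l\<in>{1..m}. if p l \<le> \<alpha> i then 1 else (0::real))) :: real)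
      \<in> borel_measurable (\<Pi>\<^sub>M j\<in>{1..m}. borel)"
    by measurable
  ultimately show ?thesis by simp
next
  case False
  hence "j \<le> num_rejected m \<alpha> p \<longleftrightarrow> j = 0" for p
    using num_rejected_le[of m \<alpha> p] by auto
  thus ?thesis by simp
qed

text \<open>
  The critical value met by a rejected hypothesis is that of its own rank, which is at most the
  number of rejections.
\<close>
lemma rejected_pval_le:
  assumes lin: "\<And>j. j \<in> {1..m} \<Longrightarrow> \<alpha> j \<le> c * real j" and c: "0 \<le> c"
    and i: "i \<in> stepdown_rejected m \<alpha> p"
  shows "p i \<le> c * real (num_rejected m \<alpha> p)"
proof -
  have ne: "stepdown_indices m \<alpha> p \<noteq> {}"
    using i by (auto simp: stepdown_rejected_def)
  hence "i \<in> ordered_hyp m p ` {1..num_rejected m \<alpha> p}"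
    using i by (simp add: stepdown_rejected_def num_rejected_eq)
  then obtain j where j: "1 \<le> j" "j \<le> num_rejected m \<alpha> p" "i = ordered_hyp m p j"
    by auto
  hence "j \<in> stepdown_indices m \<alpha> p"
    by (simp add: le_num_rejected_iff)
  hence jm: "j \<le> m" and "p i \<le> \<alpha> j"
    using j by (auto simp: stepdown_indices_def ordered_pval_def)
  note \<open>p i \<le> \<alpha> j\<close>
  also have "\<alpha> j \<le> c * real j"
    using lin j jm by simp
  also have "\<dots> \<le> c * real (num_rejected m \<alpha> p)"
    using j c by (intro mult_left_mono) auto
  finally show ?thesis by simp
qed

section \<open>Control of the false discovery rate\<close>

text \<open>
  Solving for \<open>a\<close> gives \<open>a = i q / (m - i + \<beta> + i q)\<close>, and the denominator is at least
  \<open>m + (m - i) (1 - q) \<ge> m\<close>.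
\<close>
lemma critical_value_le:
  fixes a q \<beta> :: real
  assumes i: "1 \<le> i" "i \<le> m" and q: "0 < q" "q < 1" and \<beta>: "\<beta> \<ge> real m * (1 - q)"
    and a: "a / (1 - a) = real i * q / (real m - real i + \<beta>)"
  shows "a \<le> q / real m * real i"
proof -
  have "0 < real m * (1 - q)"
    using i q by simp
  hence D: "0 < real m - real i + \<beta>"
    using \<beta> i by linarith
  have "a \<noteq> 1"
    using a D i q by auto
  hence eq: "a * (real m - real i + \<beta> + real i * q) = real i * q"
    using a D by (simp add: field_simps)
  have "0 \<le> (real m - real i) * (1 - q)"
    using i q by simp
  hence E: "real m \<le> real m - real i + \<beta> + real i * q"
    using \<beta> by (simp add: algebra_simps)
  have iq: "0 < real i * q"
    using i q by simp
  have "0 < a"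
    using eq iq D by (metis add_pos_pos zero_less_mult_pos2)
  hence "a * real m \<le> real i * q"
    using E eq by (metis less_imp_le mult_left_mono)
  thus ?thesis
    using i by (simp add: field_simps)
qed

theorem theoremA1:
  fixes M :: "'a measure" and m :: nat and q \<beta> :: real
    and I0 :: "nat set" and P :: "nat \<Rightarrow> 'a \<Rightarrow> real" and \<alpha> :: "nat \<Rightarrow> real"
  assumes "prob_space M"
    and "m \<ge> 1" and "0 < q" and "q < 1"
    and "I0 \<subseteq> {1..m}"
    and "\<And>i. i \<in> {1..m} \<Longrightarrow> P i \<in> borel_measurable M"
    and "\<And>i \<omega>. i \<in> {1..m} \<Longrightarrow> \<omega> \<in> space M \<Longrightarrow> P i \<omega> \<in> {0..1}"
    and "\<And>i. i \<in> I0 \<Longrightarrow> distr M borel (P i) = uniform_measure lborel {0<..<1}"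
    and "PRDS M m P I0"
    and "\<beta> \<ge> real m * (1 - q)"
    and "mono_on {1..m} \<alpha>"
    and "\<And>i. i \<in> {1..m} \<Longrightarrow>
           \<alpha> i / (1 - \<alpha> i) = real i * q / (real m - real i + \<beta>)"
  shows "FDR M m I0 \<alpha> P \<le> q"
proof -
  interpret prob_space M by fact
  note I0 = assms(5) and P = assms(6) and P01 = assms(7) and unif = assms(8) and prds = assms(9)
  define c where "c = q / real m"
  define R where "R \<omega> = num_rejected m \<alpha> (pvec m P \<omega>)" for \<omega>
  define f where "f i \<omega> = (if 0 < R \<omega> \<and> P i \<omega> \<le> c * real (R \<omega>) then 1 / real (R \<omega>) else 0)" for i \<omega>
  have c: "0 < c" "c * real m \<le> 1"
    using assms(2-4) by (auto simp: c_def)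
  have lin: "\<alpha> j \<le> c * real j" if "j \<in> {1..m}" for j
    using critical_value_le[of j m q \<beta> "\<alpha> j"] assms(3,4,10) assms(12)[OF that] that
    by (simp add: c_def)
  have pvec [measurable]: "pvec m P \<in> measurable M (\<Pi>\<^sub>M j\<in>{1..m}. borel)"
    unfolding pvec_def[abs_def] by (intro measurable_restrict P)
  have bool_R [measurable]: "(\<lambda>\<omega>. of_bool (j \<le> R \<omega>) :: real) \<in> borel_measurable M" for j
    unfolding R_def by (rule measurable_compose[OF pvec measurable_of_bool_le_num_rejected])
  have R [measurable]: "R \<in> measurable M (count_space UNIV)"
  proof -
    have "(\<Sum>j=1..m. of_bool (j \<le> R \<omega>)) = real (R \<omega>)" for \<omega>
    proof -
      have "{1..m} \<inter> {j. j \<le> R \<omega>} = {1..R \<omega>}"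
        using num_rejected_le[of m \<alpha> "pvec m P \<omega>"] by (auto simp: R_def)
      thus ?thesis by (simp add: sum.If_cases of_bool_def)
    qed
    moreover have "(\<lambda>\<omega>. \<Sum>j=1..m. of_bool (j \<le> R \<omega>) :: real) \<in> borel_measurable M"
      by measurable
    ultimately have [measurable]: "(\<lambda>\<omega>. real (R \<omega>)) \<in> borel_measurable M"
      by simp
    have "(\<lambda>\<omega>. nat \<lfloor>real (R \<omega>)\<rfloor>) \<in> measurable M (count_space UNIV)"
      by measurable
    thus ?thesis by simp
  qed
  have int_f: "integrable M (f i)" if "i \<in> I0" for i
  proof -
    have [measurable]: "P i \<in> borel_measurable M"
      using P that I0 by auto
    have "f i \<in> borel_measurable M"
      unfolding f_def[abs_def] by measurable
    thus ?thesis
      by (rule Bochner_Integration.integrable_bound[OF integrable_const[of "1::real"]])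
        (auto simp: f_def)
  qed
  have bound: "(\<integral>\<omega>. f i \<omega> \<partial>M) \<le> c" if i: "i \<in> I0" for i
    unfolding f_def
  proof (rule expectation_inverse_rejections[OF _ _ _ R _ _ c])
    show Pi [measurable]: "P i \<in> borel_measurable M"
      using P i I0 by auto
    show "P i \<omega> \<in> {0..1}" if "\<omega> \<in> space M" for \<omega>
      using P01 i I0 that by auto
    show "R \<omega> \<le> m" for \<omega>
      by (simp add: R_def num_rejected_le)
    show "prob {\<omega>\<in>space M. P i \<omega> \<le> t} = t" if t: "t \<in> {0..1}" for t
    proof -
      have "prob {\<omega>\<in>space M. P i \<omega> \<le> t} = measure (distr M borel (P i)) {..t}"
        by (subst measure_distr) (auto intro!: arg_cong[where f = prob])
      also have "\<dots> = measure lborel ({0<..<1} \<inter> {..t})"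
        using unif[OF i] by (simp add: measure_uniform_measure)
      also have "\<dots> = t"
      proof (cases "t = 1")
        case True
        hence "{0<..<1} \<inter> {..t} = {0<..<1}" by auto
        thus ?thesis using True by simp
      next
        case False
        hence "{0<..<1} \<inter> {..t} = {0<..t}" using t by auto
        thus ?thesis using t by simp
      qed
      finally show ?thesis .
    qed
    show "\<exists>g. cond_exp_version M (\<lambda>\<omega>. of_bool (j \<le> R \<omega>)) (P i) g \<and> antimono_on {0..1} g" for j
    proof -
      let ?\<phi> = "\<lambda>p. of_bool (j \<le> num_rejected m \<alpha> p) :: real"
      have "integrable M (\<lambda>\<omega>. ?\<phi> (pvec m P \<omega>))"
        using bool_R[of j] unfolding R_def
        by (rule Bochner_Integration.integrable_bound[OF integrable_const[of "1::real"]]) auto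
      moreover have "antimono_on (cube m) ?\<phi>"
        using num_rejected_antimono by (intro monotone_onI) (auto intro: order_trans)
      ultimately show ?thesis
        using bspec[OF bspec[OF prds[unfolded PRDS_def] i]
            measurable_of_bool_le_num_rejected[of j m \<alpha>]]
        unfolding R_def by iprover
    qed
  qed
  have "FDR M m I0 \<alpha> P \<le> (\<integral>\<omega>. (\<Sum>i\<in>I0. f i \<omega>) \<partial>M)"
    unfolding FDR_def
    \<comment> \<open>Only the majorant has to be measurable here, so \<open>V\<close> never needs to be.\<close>
  proof (rule integral_mono')
    show "integrable M (\<lambda>\<omega>. \<Sum>i\<in>I0. f i \<omega>)"
      by (intro Bochner_Integration.integrable_sum int_f)
    show "0 \<le> (\<Sum>i\<in>I0. f i \<omega>)" for \<omega>
      by (intro sum_nonneg) (simp add: f_def)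
    show "(let p = pvec m P \<omega>; R = num_rejected m \<alpha> p; V = num_false_rejected m I0 \<alpha> p
          in if R > 0 then real V / real R else 0) \<le> (\<Sum>i\<in>I0. f i \<omega>)" for \<omega>
    proof (cases "R \<omega> = 0")
      case True
      thus ?thesis by (simp add: R_def f_def)
    next
      case False
      let ?S = "stepdown_rejected m \<alpha> (pvec m P \<omega>)"
      have fin: "finite I0"
        by (rule finite_subset[OF I0]) simp
      have "real (card (?S \<inter> I0)) / real (R \<omega>) = (\<Sum>i\<in>?S \<inter> I0. 1 / real (R \<omega>))"
        by simp
      also have "\<dots> = (\<Sum>i\<in>?S \<inter> I0. f i \<omega>)"
      proof (rule sum.cong)
        fix i assume i: "i \<in> ?S \<inter> I0"
        hence "pvec m P \<omega> i = P i \<omega>"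
          using I0 by (auto simp: pvec_def)
        thus "1 / real (R \<omega>) = f i \<omega>"
          using rejected_pval_le[of m \<alpha> c i "pvec m P \<omega>"] lin c i False
          by (simp add: f_def R_def)
      qed simp
      also have "\<dots> \<le> (\<Sum>i\<in>I0. f i \<omega>)"
        by (rule sum_mono2[OF fin]) (auto simp: f_def)
      finally show ?thesis
        using False by (simp add: R_def num_false_rejected_def Let_def)
    qed
  qed
  also have "\<dots> = (\<Sum>i\<in>I0. \<integral>\<omega>. f i \<omega> \<partial>M)"
    by (intro Bochner_Integration.integral_sum int_f)
  also have "\<dots> \<le> real (card I0) * c"
    using bound by (intro sum_bounded_above) auto
  also have "\<dots> \<le> real m * c"
    using card_mono[OF _ I0] c by (intro mult_right_mono) auto
  also have "\<dots> = q"
    using assms(2) by (simp add: c_def)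
  finally show ?thesis .
qed

end
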